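(* Let $k>1$ and $n-k>1$, and let $\mathbf{V}$ be the tautological rank $k$ bundle over the Grassmannian $\mathbb{G}_k(\mathbb{R}^n)$ of oriented $k$-planes in $\mathbb{R}^n$, with orthogonal complement bundle $\mathbf{V}^\perp$ and twistor-type operator $D=\pi_2\circ\nabla^{\mathbf V}$. A section $s\in\Gamma(\mathbf{V})$ satisfies $Ds=0$ if and only if there exists a section $s'\in\Gamma(\mathbf{V}^\perp)$ such that $s+s'=A$ is a constant section of the trivial bundle $\mathbb{G}_k(\mathbb{R}^n)\times\mathbb{R}^n$.
   Context: $\mathbb{R}^n$ carries an inner product $\langle\cdot,\cdot\rangle$. $\mathbb{G}_k(\mathbb{R}^n)$ is the Grassmannian of oriented $k$-planes; its tangent space at $V$ is $\mathrm{Hom}(V,V^\perp)\cong V\otimes V^\perp$ (using the metric), and likewise $T^*_V\mathbb{G}_k(\mathbb{R}^n)\cong V\otimes V^\perp$. The trivial bundle splits orthogonally as $\mathbb{G}_k(\mathbb{R}^n)\times\mathbb{R}^n=\mathbf{V}\oplus\mathbf{V}^\perp$, where $\mathbf{V}$ is the tautological bundle (fibre $V$ over $V$); $\pi,\pi^\perp$ are the orthogonal projections onto $\mathbf{V}$, $\mathbf{V}^\perp$. The connection on $\mathbf{V}$ is $\nabla^{\mathbf V}s=\pi\,ds$, where $d$ is the flat derivative of $\mathbb{R}^n$-valued functions; thus $\nabla^{\mathbf V}s\in\Gamma(T^*\otimes\mathbf{V})\cong\Gamma(\mathbf{V}^\perp\otimes\mathbf{V}\otimes\mathbf{V})$. There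 is a decomposition $\mathbf{V}^\perp\otimes\mathbf{V}\otimes\mathbf{V}\cong(\mathbf{V}^\perp\otimes\mathbb{R})\oplus\bigl(\mathbf{V}^\perp\otimes(\mathbf{V}\otimes\mathbf{V})_0\bigr)$, where $(\mathbf{V}\otimes\mathbf{V})_0$ is the trace-free part and the first summand consists of the elements $\sum_i y\otimes v_i\otimes v_i$ with $y\in\mathbf{V}^\perp$ and $(v_i)$ an orthonormal basis of the fibre of $\mathbf V$. $\pi_2$ denotes the projection onto the second summand, and $D:=\pi_2\circ\nabla^{\mathbf V}$. Sections are smooth. *)

theory Defs
  imports "HOL-Analysis.Analysis"
begin

text \<open>
  The Euclidean space is an arbitrary type \<open>'a::euclidean_space\<close> (so \<open>n = DIM('a)\<close>, with its
  inner product), and the rank is \<open>k = CARD('k)\<close>; \<open>k\<close>-frames are vectors \<open>'a^'k\<close>.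
\<close>

section \<open>Smooth maps\<close>

text \<open>For finite-dimensional \<open>'a\<close> this is the usual notion of a \<open>C\<^sup>m\<close> map on the whole space:
  all iterated directional derivatives up to order \<open>m\<close> exist and are continuous.\<close>

fun Cm :: "nat \<Rightarrow> ('a::real_normed_vector \<Rightarrow> 'b::real_normed_vector) \<Rightarrow> bool" where
  "Cm 0 f \<longleftrightarrow> continuous_on UNIV f"
| "Cm (Suc m) f \<longleftrightarrow> (\<forall>x. f differentiable (at x)) \<and>
     (\<forall>v. Cm m (\<lambda>x. frechet_derivative f (at x) v))"

definition smooth :: "('a::real_normed_vector \<Rightarrow> 'b::real_normed_vector) \<Rightarrow> bool" where
  "smooth f \<longleftrightarrow> (\<forall>m. Cm m f)"

section \<open>Oriented planes\<close>

definition frames :: "'a::euclidean_space set \<Rightarrow> ('a^'k) set" where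
  "frames V = {b. inj (($) b) \<and> independent (range (($) b)) \<and> span (range (($) b)) = V}"

definition same_orientation :: "'a::euclidean_space set \<Rightarrow> (('a^'k) \<times> ('a^'k)) set" where
  "same_orientation V = {(b, b'). b \<in> frames V \<and> b' \<in> frames V \<and>
     (\<exists>M::real^'k^'k. det M > 0 \<and> (\<forall>i. b' $ i = (\<Sum>j\<in>UNIV. M $ i $ j *\<^sub>R b $ j)))}"

type_synonym ('a, 'k) oplane = "'a set \<times> ('a^'k) set"

text \<open>A point of the oriented Grassmannian is a subspace together with one of its
  orientation classes of ordered bases.\<close>

definition oriented_grassmannian :: "('a::euclidean_space, 'k::finite) oplane set" where
  "oriented_grassmannian = {(V, orn). subspace V \<and> dim V = CARD('k) \<and>
     orn \<in> (frames V :: ('a^'k) set) // same_orientation V}"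

section \<open>Smooth structure, tangent vectors and sections\<close>

definition oproj :: "'a::euclidean_space set \<Rightarrow> 'a \<Rightarrow> 'a" where
  "oproj V x = (THE p. p \<in> V \<and> x - p \<in> V\<^sup>\<bottom>)"

text \<open>
  The graph chart centred at \<open>P = (V, orn)\<close> sends \<open>L \<in> Hom(V, V\<^sup>\<bottom>)\<close> to the graph
  \<open>{v + L v | v \<in> V}\<close>, oriented so that \<open>v \<mapsto> v + L v\<close> preserves orientation. In order to have a
  whole vector space as its domain, it is precomposed with the linear surjection
  \<open>L \<mapsto> (\<lambda>v \<in> V. oproj (V\<^sup>\<bottom>) (L v))\<close> from all endomorphisms onto \<open>Hom(V, V\<^sup>\<bottom>)\<close>;
  this does not affect which functions are smooth in the chart, nor their derivatives in the
  directions of \<open>Hom(V, V\<^sup>\<bottom>)\<close>.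
\<close>

definition graph_map :: "'a::euclidean_space set \<Rightarrow> ('a \<Rightarrow>\<^sub>L 'a) \<Rightarrow> 'a \<Rightarrow> 'a" where
  "graph_map V L v = v + oproj (V\<^sup>\<bottom>) (blinfun_apply L v)"

definition graph_chart ::
  "('a::euclidean_space, 'k::finite) oplane \<Rightarrow> ('a \<Rightarrow>\<^sub>L 'a) \<Rightarrow> ('a, 'k) oplane" where
  "graph_chart P L =
     (graph_map (fst P) L ` fst P, (\<lambda>b. \<chi> i. graph_map (fst P) L (b $ i)) ` snd P)"

definition smooth_on_grassmannian ::
  "(('a::euclidean_space, 'k::finite) oplane \<Rightarrow> 'a) \<Rightarrow> bool" where
  "smooth_on_grassmannian f \<longleftrightarrow>
     (\<forall>P\<in>oriented_grassmannian. smooth (\<lambda>L. f (graph_chart P L)))"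

text \<open>The flat derivative \<open>df\<close> at \<open>P\<close> in the direction of the tangent vector
  \<open>L \<in> Hom(V, V\<^sup>\<bottom>)\<close>.\<close>

definition flat_deriv ::
  "(('a::euclidean_space, 'k::finite) oplane \<Rightarrow> 'a) \<Rightarrow> ('a, 'k) oplane \<Rightarrow> ('a \<Rightarrow>\<^sub>L 'a) \<Rightarrow> 'a" where
  "flat_deriv f P L = frechet_derivative (\<lambda>L. f (graph_chart P L)) (at 0) L"

definition sections_taut :: "(('a::euclidean_space, 'k::finite) oplane \<Rightarrow> 'a) set" where
  "sections_taut = {s. smooth_on_grassmannian s \<and> (\<forall>P\<in>oriented_grassmannian. s P \<in> fst P)}"

definition sections_perp :: "(('a::euclidean_space, 'k::finite) oplane \<Rightarrow> 'a) set" where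
  "sections_perp =
     {s. smooth_on_grassmannian s \<and> (\<forall>P\<in>oriented_grassmannian. s P \<in> (fst P)\<^sup>\<bottom>)}"

definition nabla ::
  "(('a::euclidean_space, 'k::finite) oplane \<Rightarrow> 'a) \<Rightarrow> ('a, 'k) oplane \<Rightarrow> ('a \<Rightarrow>\<^sub>L 'a) \<Rightarrow> 'a" where
  "nabla s P L = oproj (fst P) (flat_deriv s P L)"

section \<open>Tensors\<close>

text \<open>Via the metric, \<open>u \<otimes> w\<close> is the linear map \<open>x \<mapsto> \<langle>x, u\<rangle> w\<close>; threefold tensors associate
  to the right.\<close>

definition tens :: "'a::real_inner \<Rightarrow> 'b::real_normed_vector \<Rightarrow> 'a \<Rightarrow>\<^sub>L 'b" (infixr "\<otimes>" 76) where
  "u \<otimes> w = blinfun_scaleR_left w o\<^sub>L blinfun_inner_left u"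

lemma tens_apply: "blinfun_apply (u \<otimes> w) x = (x \<bullet> u) *\<^sub>R w"
  by (simp add: tens_def)

definition tensor_prod ::
  "'a::real_inner set \<Rightarrow> 'b::real_normed_vector set \<Rightarrow> ('a \<Rightarrow>\<^sub>L 'b) set" where
  "tensor_prod U W = span {u \<otimes> w | u w. u \<in> U \<and> w \<in> W}"

text \<open>The linear extension of \<open>v \<otimes> w \<mapsto> \<langle>v, w\<rangle>\<close>.\<close>

definition tensor_trace :: "('a::euclidean_space \<Rightarrow>\<^sub>L 'a) \<Rightarrow> real" where
  "tensor_trace A = (\<Sum>b\<in>Basis. blinfun_apply A b \<bullet> b)"

definition trace_summand :: "'a::euclidean_space set \<Rightarrow> ('a \<Rightarrow>\<^sub>L 'a \<Rightarrow>\<^sub>L 'a) set" where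
  "trace_summand V = {\<Sum>v\<in>B. y \<otimes> v \<otimes> v | y B. y \<in> V\<^sup>\<bottom> \<and>
     B \<subseteq> V \<and> pairwise orthogonal B \<and> (\<forall>v\<in>B. norm v = 1) \<and> span B = V}"

definition tracefree_summand :: "'a::euclidean_space set \<Rightarrow> ('a \<Rightarrow>\<^sub>L 'a \<Rightarrow>\<^sub>L 'a) set" where
  "tracefree_summand V = tensor_prod (V\<^sup>\<bottom>) {A \<in> tensor_prod V V. tensor_trace A = 0}"

text \<open>The projection of \<open>V\<^sup>\<bottom> \<otimes> V \<otimes> V\<close> onto the second summand along the first one.\<close>

definition pi2 :: "'a::euclidean_space set \<Rightarrow> ('a \<Rightarrow>\<^sub>L 'a \<Rightarrow>\<^sub>L 'a) \<Rightarrow> ('a \<Rightarrow>\<^sub>L 'a \<Rightarrow>\<^sub>L 'a)" where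
  "pi2 V T = (THE T'. T' \<in> tracefree_summand V \<and> T - T' \<in> trace_summand V)"

text \<open>
  The covariant derivative as an element of \<open>V\<^sup>\<bottom> \<otimes> V \<otimes> V\<close>: its value on \<open>y \<in> V\<^sup>\<bottom>\<close>
  and \<open>v \<in> V\<close> is the derivative in the direction of the tangent vector
  \<open>v \<otimes> y \<in> V \<otimes> V\<^sup>\<bottom> = Hom(V, V\<^sup>\<bottom>)\<close>, so the middle factor is the \<open>V\<close>-slot of the cotangent
  space and the last one is the fibre of the bundle. For smooth \<open>s\<close> the maps under \<open>Blinfun\<close>
  are linear.
\<close>

definition nabla_tensor ::
  "(('a::euclidean_space, 'k::finite) oplane \<Rightarrow> 'a) \<Rightarrow> ('a, 'k) oplane \<Rightarrow> ('a \<Rightarrow>\<^sub>L 'a \<Rightarrow>\<^sub>L 'a)" where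
  "nabla_tensor s P =
     Blinfun (\<lambda>y. Blinfun (\<lambda>v. nabla s P (oproj (fst P) v \<otimes> oproj ((fst P)\<^sup>\<bottom>) y)))"

definition twistor_D ::
  "(('a::euclidean_space, 'k::finite) oplane \<Rightarrow> 'a) \<Rightarrow> ('a, 'k) oplane \<Rightarrow> ('a \<Rightarrow>\<^sub>L 'a \<Rightarrow>\<^sub>L 'a)" where
  "twistor_D s P = pi2 (fst P) (nabla_tensor s P)"

end

theory Submission
  imports Defs
begin

text \<open>
  Both directions rest on one reformulation: a section \<open>s\<close> of the tautological bundle is completed by a
  normal section to a constant \<open>A\<close> iff \<open>s P \<bullet> w = A \<bullet> w\<close> for every vector \<open>w\<close> of every oriented
  plane \<open>P\<close>, that is, iff \<open>s P\<close> is the orthogonal projection of \<open>A\<close> to \<open>P\<close>.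

  If \<open>s\<close> is such a projection, differentiating this identity in the direction \<open>v \<otimes> y\<close> gives
  \<open>\<nabla>s(v \<otimes> y) = (y \<bullet> A) v\<close> (\<open>nabla_projection_of_constant\<close>). So \<open>\<nabla>s\<close> is a pure trace tensor and
  \<open>Ds = 0\<close>.

  Conversely, \<open>Ds = 0\<close> forces each \<open>\<nabla>s(v \<otimes> y)\<close> to be a multiple of \<open>v\<close>
  (\<open>twistor_D_eq_0_iff\<close>). Rotate a plane about a hyperplane \<open>U\<close> of it: the velocity is \<open>v \<otimes> y\<close> with
  \<open>v\<close> orthogonal to \<open>U\<close>, so \<open>s \<bullet> w\<close> stays constant for each \<open>w\<close> in \<open>U\<close>
  (\<open>inner_section_const_rotation\<close>). Any two oriented planes through \<open>w\<close> are joined by finitely many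
  such rotations that fix \<open>w\<close>, so \<open>h w = s P \<bullet> w\<close> depends on \<open>w\<close> alone
  (\<open>inner_section_const\<close>). Since \<open>k > 1\<close>, two vectors lie in a common plane, on which \<open>h\<close> is
  linear; hence \<open>h\<close> is linear on the whole space and is the inner product with a vector \<open>A\<close>
  (\<open>section_is_projection\<close>). The normal section is \<open>s' = A - s\<close>.
\<close>

section \<open>Orthogonal projections and intermediate subspaces\<close>

lemma orthogonal_comp_iff: "y \<in> V\<^sup>\<bottom> \<longleftrightarrow> (\<forall>x\<in>V. x \<bullet> y = 0)"
  by (simp add: orthogonal_comp_def orthogonal_def)

lemma oproj_unique:
  assumes "subspace V" "p \<in> V" "x - p \<in> V\<^sup>\<bottom>"
  shows "oproj V x = p"
  unfolding oproj_def
proof (rule the_equality)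
  fix q assume q: "q \<in> V \<and> x - q \<in> V\<^sup>\<bottom>"
  have "p - q \<in> V" using assms q by (simp add: subspace_diff)
  moreover have "p - q \<in> V\<^sup>\<bottom>"
    using subspace_diff[OF subspace_orthogonal_comp, of "x - q" V "x - p"] assms q by simp
  ultimately have "(p - q) \<bullet> (p - q) = 0" by (simp add: orthogonal_comp_iff)
  then show "q = p" by simp
qed (use assms in simp)

lemma oproj_in:
  assumes "subspace V" shows "oproj V x \<in> V" and "x - oproj V x \<in> V\<^sup>\<bottom>"
proof -
  obtain y z where "y \<in> V" "z \<in> V\<^sup>\<bottom>" "x = y + z"
    using subspace_sum_orthogonal_comp[OF assms] by (metis UNIV_I set_plus_elim)
  then have "oproj V x = y" by (intro oproj_unique) (auto simp: assms)
  with \<open>y \<in> V\<close> \<open>z \<in> V\<^sup>\<bottom>\<close> \<open>x = y + z\<close>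
  show "oproj V x \<in> V" and "x - oproj V x \<in> V\<^sup>\<bottom>" by auto
qed

lemma oproj_eq_self_iff:
  assumes "subspace V"
  shows "oproj V x = x \<longleftrightarrow> x \<in> V"
  using assms oproj_in[OF assms, of x] oproj_unique[OF assms, of x x]
  by (auto simp: subspace_0 subspace_orthogonal_comp)

lemma linear_oproj:
  assumes "subspace V" shows "linear (oproj V)"
proof (rule linearI)
  fix x y :: 'a and c :: real
  have "x + y - (oproj V x + oproj V y) = (x - oproj V x) + (y - oproj V y)" by simp
  also have "\<dots> \<in> V\<^sup>\<bottom>"
    by (intro subspace_add subspace_orthogonal_comp oproj_in assms)
  finally show "oproj V (x + y) = oproj V x + oproj V y"
    by (intro oproj_unique subspace_add oproj_in assms)
  have "c *\<^sub>R x - c *\<^sub>R oproj V x = c *\<^sub>R (x - oproj V x)" by (simp add: scaleR_diff_right)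
  then show "oproj V (c *\<^sub>R x) = c *\<^sub>R oproj V x"
    using oproj_in[OF assms] assms
    by (intro oproj_unique) (auto intro!: subspace_scale subspace_orthogonal_comp)
qed

lemma inner_oproj:
  assumes "subspace V" "w \<in> V" shows "oproj V x \<bullet> w = x \<bullet> w"
  using oproj_in(2)[OF assms(1), of x] assms(2)
  by (simp add: orthogonal_comp_iff inner_diff_right inner_commute)

lemma subspace_between:
  fixes S T :: "'a::euclidean_space set"
  assumes "subspace S" "subspace T" "S \<subseteq> T" "dim S \<le> m" "m \<le> dim T"
  obtains U where "subspace U" "S \<subseteq> U" "U \<subseteq> T" "dim U = m"
proof -
  obtain B where B: "B \<subseteq> S" "independent B" "S \<subseteq> span B" "card B = dim S"
    using basis_exists by blast
  obtain C where C: "B \<subseteq> C" "C \<subseteq> T" "independent C" "T \<subseteq> span C"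
    using maximal_independent_subset_extend[of B T] B assms(3) by (metis order_trans)
  have "card C = dim T" by (rule basis_card_eq_dim) (use C in auto)
  then obtain D where D: "B \<subseteq> D" "D \<subseteq> C" "card D = m"
    using exists_subset_between[of B m C] B C assms independent_imp_finite by (metis)
  show thesis
  proof
    show "S \<subseteq> span D" using B D span_mono by blast
    show "span D \<subseteq> T" using C D assms by (metis order_trans span_minimal)
    show "dim (span D) = m" using D C by (metis dim_eq_card_independent dim_span independent_mono)
  qed simp
qed

section \<open>Frames and oriented planes\<close>

text \<open>A tuple \<open>b\<close> is a frame of \<open>V\<close> exactly when \<open>x \<mapsto> \<Sum>\<^sub>j x\<^sub>j b\<^sub>j\<close> is a bijection from the
  coordinate space onto \<open>V\<close>. Through this map a change of frame becomes the transpose of a matrix,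
  so composition, inversion and determinants of base changes are those of matrices.\<close>
definition lincomb :: "'a::real_vector ^ 'k \<Rightarrow> real ^ 'k \<Rightarrow> 'a" where
  "lincomb b x = (\<Sum>j\<in>UNIV. x $ j *\<^sub>R b $ j)"

lemma linear_lincomb: "linear (lincomb b)"
  by (rule linearI) (simp_all add: lincomb_def scaleR_add_left sum.distrib scaleR_sum_right)

lemma lincomb_axis: "lincomb b (axis j 1) = b $ j"
  unfolding lincomb_def by (subst sum.remove[of _ j]) (auto simp: axis_def)

lemma range_lincomb: "range (lincomb b) = span (range (($) b))"
proof
  show "range (lincomb b) \<subseteq> span (range (($) b))"
    unfolding lincomb_def by (force intro: span_sum span_scale span_base)
  have "subspace (range (lincomb b))"
    using linear_subspace_image[OF linear_lincomb subspace_UNIV] .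
  moreover have "range (($) b) \<subseteq> range (lincomb b)"
    using lincomb_axis[of b] by (metis image_subset_iff rangeI)
  ultimately show "span (range (($) b)) \<subseteq> range (lincomb b)" by (simp add: span_minimal)
qed

lemma frames_iff:
  "b \<in> frames V \<longleftrightarrow> inj (lincomb b) \<and> range (lincomb b) = V"
proof -
  have "inj (lincomb b) \<longleftrightarrow> inj (($) b) \<and> independent (range (($) b))"
  proof
    assume inj: "inj (lincomb b)"
    have *: "($) b = lincomb b \<circ> (\<lambda>j. axis j 1)" by (auto simp: lincomb_axis)
    have i: "inj (\<lambda>j. axis j (1::real))" by (simp add: inj_def axis_eq_axis)
    have "inj (($) b)" unfolding * using inj_compose[OF inj i] .
    moreover have "independent (range (\<lambda>j::'b. axis j (1::real)))"
      by (rule pairwise_orthogonal_independent)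
         (auto simp: pairwise_def orthogonal_def inner_axis_axis axis_eq_axis)
    then have "independent (range (($) b))"
      unfolding * image_comp[symmetric]
      using linear_independent_injective_image[OF linear_lincomb _ inj_on_subset[OF inj]] by blast
    ultimately show "inj (($) b) \<and> independent (range (($) b))" ..
  next
    assume A: "inj (($) b) \<and> independent (range (($) b))"
    have "x = 0" if "lincomb b x = 0" for x
    proof -
      have "(\<Sum>v\<in>range (($) b). x $ (inv (($) b) v) *\<^sub>R v) = 0"
        using that A by (simp add: sum.reindex lincomb_def)
      then have "\<forall>v\<in>range (($) b). x $ (inv (($) b) v) = 0"
        using A independentD[of "range (($) b)" "range (($) b)" "\<lambda>v. x $ (inv (($) b) v)"] by auto
      then show ?thesis using A by (simp add: vec_eq_iff)
    qed
    then show "inj (lincomb b)" by (simp add: linear_injective_0[OF linear_lincomb])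
  qed
  then show ?thesis by (auto simp: frames_def range_lincomb)
qed

definition rebase :: "real ^ 'k ^ 'k \<Rightarrow> 'a::real_vector ^ 'k \<Rightarrow> 'a ^ 'k" where
  "rebase M b = (\<chi> i. \<Sum>j\<in>UNIV. M $ i $ j *\<^sub>R b $ j)"

lemma rebase_lincomb: "rebase M b $ i = lincomb b (M $ i)"
  by (simp add: rebase_def lincomb_def)

lemma lincomb_rebase: "lincomb (rebase M b) x = lincomb b (transpose M *v x)"
proof -
  have "lincomb (rebase M b) x = (\<Sum>i\<in>UNIV. \<Sum>j\<in>UNIV. (x $ i * M $ i $ j) *\<^sub>R b $ j)"
    by (simp add: lincomb_def rebase_def scaleR_sum_right)
  also have "\<dots> = (\<Sum>j\<in>UNIV. \<Sum>i\<in>UNIV. (x $ i * M $ i $ j) *\<^sub>R b $ j)" by (rule sum.swap)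
  finally show ?thesis
    by (simp add: lincomb_def matrix_vector_mult_def transpose_def scaleR_sum_left mult.commute)
qed

lemma rebase_rebase: "rebase M (rebase N b) = rebase (M ** N) b"
proof -
  have "transpose N *v (M $ i) = (M ** N) $ i" for i
    by (simp add: vec_eq_iff matrix_vector_mult_def matrix_matrix_mult_def transpose_def mult.commute)
  then show ?thesis
    by (simp add: vec_eq_iff[of "rebase _ _"] rebase_lincomb lincomb_rebase del: vector_transpose_matrix transpose_matrix_vector)
qed

lemma inj_transpose_iff_det:
  fixes M :: "real ^ 'k ^ 'k"
  shows "inj ((*v) (transpose M)) \<longleftrightarrow> det M \<noteq> 0"
  using det_nz_iff_inj[OF matrix_vector_mul_linear, of "transpose M"]
  unfolding matrix_of_matrix_vector_mul det_transpose by (rule sym)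

lemma frames_rebase:
  assumes "b \<in> frames V" "det M \<noteq> 0"
  shows "rebase M b \<in> frames V"
proof -
  have "bij ((*v) (transpose M))"
    unfolding bij_def using assms(2)
    by (intro conjI linear_inj_imp_surj matrix_vector_mul_linear; unfold inj_transpose_iff_det)
  moreover have "lincomb (rebase M b) = lincomb b \<circ> (*v) (transpose M)"
    unfolding comp_def lincomb_rebase ..
  ultimately show ?thesis using assms(1)
    by (simp only: frames_iff bij_is_inj bij_is_surj inj_compose flip: image_comp)
qed

text \<open>The rows of \<open>M\<close> are the coordinates of the vectors of \<open>b'\<close> in the frame \<open>b\<close>. A kernel vector of
  the transpose of \<open>M\<close> would be a linear relation between the vectors of \<open>b'\<close>.\<close>
lemma frames_change:
  assumes "b \<in> frames V" "b' \<in> frames V"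
  obtains M where "det M \<noteq> 0" "b' = rebase M b"
proof -
  have "\<exists>x. b' $ i = lincomb b x" for i
    using assms by (auto simp: frames_iff) (metis lincomb_axis rangeE rangeI)
  then obtain m where m: "\<And>i. b' $ i = lincomb b (m i)" by metis
  define M where "M = (\<chi> i. m i)"
  have b': "b' = rebase M b" by (simp add: vec_eq_iff rebase_lincomb m M_def)
  have "inj ((*v) (transpose M))"
  proof (rule inj_on_subset[OF inj_on_imageI2 subset_UNIV])
    show "inj (lincomb b \<circ> (*v) (transpose M))"
      using assms(2) unfolding b' frames_iff comp_def lincomb_rebase by (elim conjE)
  qed
  with b' that show thesis unfolding inj_transpose_iff_det by blast
qed

definition frame_plane :: "'a::euclidean_space ^ 'k \<Rightarrow> ('a, 'k::finite) oplane" where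
  "frame_plane b = (span (range (($) b)), {rebase M b | M. det M > 0})"

abbreviation is_frame :: "'a::euclidean_space ^ 'k \<Rightarrow> bool" where
  "is_frame b \<equiv> b \<in> frames (span (range (($) b)))"

lemma span_frame: "b \<in> frames V \<Longrightarrow> span (range (($) b)) = V"
  by (simp add: frames_def)

text \<open>Every oriented plane is represented by a frame, its orientation class being the orbit of that frame
  under matrices of positive determinant. From here on, points of the Grassmannian are handled
  through frames.\<close>
lemma oriented_grassmannian_frames:
  "(oriented_grassmannian :: ('a::euclidean_space, 'k::finite) oplane set)
    = {frame_plane b | b. is_frame b}"
proof -
  have cls: "same_orientation V `` {b} = {rebase M b | M. det M > 0}"
    if "b \<in> frames V" for V and b :: "'a^'k"
  proof -
    have "b' = rebase M b \<longleftrightarrow> (\<forall>i. b' $ i = (\<Sum>j\<in>UNIV. M $ i $ j *\<^sub>R b $ j))" for b' M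
      by (simp add: vec_eq_iff rebase_def)
    then have "same_orientation V `` {b} = {b' \<in> frames V. \<exists>M. det M > 0 \<and> b' = rebase M b}"
      using that by (simp add: same_orientation_def Image_def)
    then show ?thesis using frames_rebase[OF that] by fastforce
  qed
  have "P \<in> oriented_grassmannian \<longleftrightarrow> (\<exists>b. is_frame b \<and> P = frame_plane b)"
    for P :: "('a, 'k) oplane"
  proof
    assume "P \<in> oriented_grassmannian"
    then obtain b where "b \<in> frames (fst P)" "snd P = same_orientation (fst P) `` {b}"
      by (auto simp: oriented_grassmannian_def elim: quotientE)
    then show "\<exists>b. is_frame b \<and> P = frame_plane b"
      using cls[of b] span_frame[of b] by (intro exI[of _ b]) (auto simp: frame_plane_def prod_eq_iff)
  next
    assume "\<exists>b. is_frame b \<and> P = frame_plane b"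
    then obtain b where b: "is_frame b" "P = frame_plane b" by blast
    then have "dim (span (range (($) b))) = CARD('k)"
      by (simp add: frames_def dim_eq_card_independent card_image)
    with b show "P \<in> oriented_grassmannian"
      by (auto simp: oriented_grassmannian_def frame_plane_def cls[symmetric] intro: quotientI)
  qed
  then show ?thesis by blast
qed

lemma fst_frame_plane: "fst (frame_plane b) = span (range (($) b))"
  by (simp add: frame_plane_def)

lemma oriented_plane_exists:
  fixes V :: "'a::euclidean_space set"
  assumes "subspace V" "dim V = CARD('k::finite)"
  obtains P :: "('a, 'k::finite) oplane" where "P \<in> oriented_grassmannian" "fst P = V"
proof -
  obtain B where B: "independent B" "span B = V" "card B = dim V" "B \<subseteq> V"
    using assms by (metis basis_exists span_eq_iff span_mono subset_antisym)
  have "finite B" using B(1) independent_imp_finite by blast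
  then obtain f where f: "bij_betw f (UNIV :: 'k set) B"
    using finite_same_card_bij[of "UNIV :: 'k set" B] assms B by auto
  define b where "b = (\<chi> i. f i)"
  have "($) b = f" by (auto simp: b_def)
  then have "b \<in> frames V" using f B by (simp add: frames_def bij_betw_def)
  then have "is_frame b" "fst (frame_plane b) = V" using span_frame by (auto simp: fst_frame_plane)
  then show thesis using that oriented_grassmannian_frames by blast
qed

lemma frame_plane_rebase:
  assumes "is_frame b" "det M > 0"
  shows "frame_plane (rebase M b) = frame_plane b"
proof -
  have "\<exists>K. rebase N b = rebase (K ** M) b \<and> det K > 0" if "det N > 0" for N
  proof -
    obtain M' where M': "M' ** M = mat 1"
      using assms(2) by (metis invertible_det_nz invertible_left_inverse order_less_irrefl)
    then have "det M' * det M = 1" by (metis det_I det_mul)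
    with assms(2) have "det M' > 0" by (metis zero_less_mult_pos2 zero_less_one)
    then show ?thesis using that M'
      by (intro exI[of _ "N ** M'"]) (simp add: det_mul matrix_mul_assoc[symmetric])
  qed
  moreover have "det (K ** M) > 0" if "det K > 0" for K using that assms by (simp add: det_mul)
  ultimately have "{rebase N (rebase M b) | N. det N > 0} = {rebase N b | N. det N > 0}"
    by (auto simp: rebase_rebase)
  moreover have "span (range (($) (rebase M b))) = span (range (($) b))"
    using span_frame[OF frames_rebase[OF assms(1)]] assms(2) by force
  ultimately show ?thesis by (simp add: frame_plane_def)
qed

definition scale_at :: "'k \<Rightarrow> real \<Rightarrow> real ^ 'k ^ 'k" where
  "scale_at j c = (\<chi> i l. if i = l then if i = j then c else 1 else 0)"

lemma det_scale_at: "det (scale_at j c) = c"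
proof -
  have "det (scale_at j c) = (\<Prod>i\<in>UNIV. if i = j then c else 1)"
    by (subst det_diagonal) (auto simp: scale_at_def)
  then show ?thesis by simp
qed

lemma rebase_scale_at: "rebase (scale_at j c) b $ i = (if i = j then c *\<^sub>R b $ i else b $ i)"
  by (simp add: rebase_def scale_at_def if_distrib[of "\<lambda>x. x *\<^sub>R _"] cong: if_cong)

text \<open>A plane has only two orientations, and reversing the sign of one vector of a frame exchanges them:
  the base change has either positive determinant or it acquires one after such a reversal.\<close>
lemma frame_plane_cases:
  assumes "b \<in> frames V" "b' \<in> frames V"
  shows "frame_plane b' = frame_plane b \<or> frame_plane (rebase (scale_at j (-1)) b') = frame_plane b"
proof -
  obtain M where M: "det M \<noteq> 0" "b' = rebase M b" using frames_change[OF assms] .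
  have b: "is_frame b" using assms span_frame by auto
  show ?thesis
  proof (cases "det M > 0")
    case True then show ?thesis using frame_plane_rebase[OF b] M by simp
  next
    case False
    then have "det (scale_at j (-1) ** M) > 0" using M by (simp add: det_mul det_scale_at)
    then show ?thesis using frame_plane_rebase[OF b] M by (simp add: rebase_rebase)
  qed
qed

lemma linear_graph_map:
  assumes "subspace V" shows "linear (graph_map V L)"
proof -
  have "linear (\<lambda>v. v + oproj (V\<^sup>\<bottom>) (blinfun_apply L v))"
    using linear_compose[OF bounded_linear.linear[OF blinfun.bounded_linear_right]
        linear_oproj[OF subspace_orthogonal_comp]]
    by (intro linear_compose_add) (auto simp: comp_def linear_id[unfolded id_def])
  then show ?thesis by (simp add: graph_map_def[abs_def])
qed

lemma inj_on_graph_map: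
  assumes "subspace V" shows "inj_on (graph_map V L) V"
proof -
  have "v = 0" if "v \<in> V" "graph_map V L v = 0" for v
  proof -
    have "v = - oproj (V\<^sup>\<bottom>) (blinfun_apply L v)"
      using that by (simp add: graph_map_def add_eq_0_iff2)
    then have "v \<in> V\<^sup>\<bottom>" by (metis oproj_in(1) subspace_neg subspace_orthogonal_comp)
    with that(1) show ?thesis by (auto simp: orthogonal_comp_iff)
  qed
  then show ?thesis using linear_inj_on_iff_eq_0[OF linear_graph_map[OF assms] assms] by blast
qed

text \<open>The map \<open>v \<mapsto> v + L v\<close> is linear and injective on \<open>V\<close>, hence it carries frames to frames and
  commutes with base changes. This computes the graph chart on frames.\<close>
lemma graph_chart_frame_plane:
  fixes b :: "'a::euclidean_space ^ 'k::finite"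
  assumes "is_frame b"
  defines "V \<equiv> span (range (($) b))"
  shows "graph_chart (frame_plane b) L = frame_plane (\<chi> i. graph_map V L (b $ i))"
    and "is_frame (\<chi> i. graph_map V L (b $ i))"
proof -
  let ?g = "graph_map V L" and ?gb = "\<chi> i. graph_map V L (b $ i)"
  have V: "subspace V" by (simp add: V_def)
  note lin = linear_graph_map[OF V, of L] and inj = inj_on_graph_map[OF V, of L]
  have img: "range (($) ?gb) = ?g ` range (($) b)" by auto
  have "?g (rebase M b $ i) = rebase M ?gb $ i" for M i
    by (simp add: rebase_def linear_sum[OF lin] linear_cmul[OF lin])
  then have "(\<lambda>b. \<chi> i. ?g (b $ i)) (rebase M b) = rebase M ?gb" for M
    by (simp add: vec_eq_iff)
  then have "(\<lambda>b. \<chi> i. ?g (b $ i)) ` {rebase M b | M. det M > 0} = {rebase M ?gb | M. det M > 0}"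
    by (auto simp: image_iff) (metis)
  moreover have "?g ` V = span (range (($) ?gb))"
    unfolding img linear_span_image[OF lin] by (simp add: V_def)
  ultimately show "graph_chart (frame_plane b) L = frame_plane ?gb"
    by (simp add: graph_chart_def frame_plane_def V_def)
  have "inj (?g \<circ> ($) b)"
    using assms(1) inj_on_subset[OF inj[unfolded V_def] span_superset]
    by (intro comp_inj_on) (auto simp: frames_def V_def)
  moreover have "?g \<circ> ($) b = ($) ?gb" by auto
  ultimately have "inj (($) ?gb)" by simp
  moreover have "independent (range (($) ?gb))"
    unfolding img using assms(1) linear_independent_injective_image[OF lin] inj
    by (simp add: frames_def V_def)
  ultimately show "is_frame ?gb" by (simp add: frames_def)
qed

section \<open>Trace and trace-free tensors\<close>

lemma linear_tens: "linear (\<lambda>u. u \<otimes> w)" "linear (\<lambda>w. u \<otimes> w)"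
  by (auto intro!: linearI blinfun_eqI
      simp: tens_apply blinfun.add_left blinfun.scaleR_left inner_add_right scaleR_add_left scaleR_add_right)

lemma oproj_orthonormal_expansion:
  fixes V :: "'a::euclidean_space set"
  assumes "subspace V" "pairwise orthogonal B" "\<forall>v\<in>B. norm v = 1" "span B = V"
  shows "(\<Sum>v\<in>B. (x \<bullet> v) *\<^sub>R v) = oproj V x"
proof -
  have fin: "finite B"
    using assms pairwise_orthogonal_imp_finite by blast
  have "(x - (\<Sum>v\<in>B. (x \<bullet> v) *\<^sub>R v)) \<bullet> b = 0" if "b \<in> B" for b
  proof -
    have "(\<Sum>v\<in>B. (x \<bullet> v) * (v \<bullet> b)) = (\<Sum>v\<in>B. if v = b then x \<bullet> b else 0)"
      using assms(2,3) that
      by (intro sum.cong refl) (auto simp: pairwise_def orthogonal_def dot_square_norm)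
    then show ?thesis using that fin by (simp add: inner_diff_left inner_sum_left)
  qed
  then have "(x - (\<Sum>v\<in>B. (x \<bullet> v) *\<^sub>R v)) \<bullet> y = 0" if "y \<in> V" for y
    using orthogonal_to_span[of y B] that assms(4) by (auto simp: orthogonal_def)
  then have "x - (\<Sum>v\<in>B. (x \<bullet> v) *\<^sub>R v) \<in> V\<^sup>\<bottom>"
    by (simp add: orthogonal_comp_iff inner_commute)
  moreover have "(\<Sum>v\<in>B. (x \<bullet> v) *\<^sub>R v) \<in> V"
    unfolding assms(4)[symmetric] by (intro span_sum span_scale span_base)
  ultimately show ?thesis using oproj_unique[OF assms(1)] by metis
qed

lemma tensor_trace_tens: "tensor_trace (u \<otimes> w) = u \<bullet> w"
  by (simp add: tensor_trace_def tens_apply euclidean_inner[of u w] inner_commute)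

lemma linear_tensor_trace: "linear tensor_trace"
  by (rule linearI) (simp_all add: tensor_trace_def blinfun.add_left blinfun.scaleR_left
      inner_add_left sum.distrib sum_distrib_left)

text \<open>For an orthonormal basis \<open>B\<close> of \<open>V\<close>, the tensor \<open>\<Sum>v\<in>B. v \<otimes> v\<close> is the orthogonal projection onto
  \<open>V\<close>, whatever \<open>B\<close> is. So the trace summand consists of the tensors \<open>z \<otimes> oproj V\<close>
  with \<open>z\<close> normal to \<open>V\<close>.\<close>
lemma trace_summand_iff:
  fixes V :: "'a::euclidean_space set"
  assumes "subspace V"
  shows "T \<in> trace_summand V \<longleftrightarrow>
    (\<exists>z\<in>V\<^sup>\<bottom>. \<forall>y v. blinfun_apply (blinfun_apply T y) v = (y \<bullet> z) *\<^sub>R oproj V v)"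
proof -
  have apply_sum: "blinfun_apply (blinfun_apply (\<Sum>v\<in>B. z \<otimes> v \<otimes> v) y) x = (y \<bullet> z) *\<^sub>R oproj V x"
    if "pairwise orthogonal B" "\<forall>v\<in>B. norm v = 1" "span B = V" for z B y x
    using oproj_orthonormal_expansion[OF assms that, of x]
    by (simp add: blinfun.sum_left tens_apply blinfun.scaleR_left flip: scaleR_sum_right)
  show ?thesis
  proof
    assume "T \<in> trace_summand V"
    then show "\<exists>z\<in>V\<^sup>\<bottom>. \<forall>y v. blinfun_apply (blinfun_apply T y) v = (y \<bullet> z) *\<^sub>R oproj V v"
      using apply_sum unfolding trace_summand_def by blast
  next
    assume "\<exists>z\<in>V\<^sup>\<bottom>. \<forall>y v. blinfun_apply (blinfun_apply T y) v = (y \<bullet> z) *\<^sub>R oproj V v"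
    then obtain z where z: "z \<in> V\<^sup>\<bottom>" "\<And>y v. blinfun_apply (blinfun_apply T y) v = (y \<bullet> z) *\<^sub>R oproj V v"
      by blast
    obtain B where B: "B \<subseteq> V" "pairwise orthogonal B" "\<forall>v\<in>B. norm v = 1" "span B = V"
      using orthonormal_basis_subspace[OF assms] by metis
    have "T = (\<Sum>v\<in>B. z \<otimes> v \<otimes> v)"
      by (intro blinfun_eqI) (simp only: apply_sum[OF B(2-4)] z(2))
    with B z(1) show "T \<in> trace_summand V" unfolding trace_summand_def by blast
  qed
qed

lemma tracefree_summand_trace:
  assumes "T \<in> tracefree_summand V"
  shows "tensor_trace (blinfun_apply T y) = 0"
proof -
  have "subspace {T. \<forall>y. tensor_trace (blinfun_apply T y) = 0}"
    by (rule subspaceI) (simp_all add: blinfun.add_left blinfun.scaleR_left linear_tensor_trace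
        linear_add linear_cmul linear_0)
  then have "T \<in> {T. \<forall>y. tensor_trace (blinfun_apply T y) = 0}"
    using assms unfolding tracefree_summand_def tensor_prod_def
    by (elim span_induct) (auto simp: tens_apply linear_tensor_trace linear_cmul)
  then show ?thesis by simp
qed

lemma tensor_trace_oproj:
  fixes V :: "'a::euclidean_space set"
  assumes "subspace V" "\<And>v. blinfun_apply A v = c *\<^sub>R oproj V v"
  shows "tensor_trace A = c * dim V"
proof -
  obtain B where B: "pairwise orthogonal B" "\<forall>v\<in>B. norm v = 1" "span B = V" "card B = dim V"
    using orthonormal_basis_subspace[OF assms(1)] by metis
  have "A = c *\<^sub>R (\<Sum>v\<in>B. v \<otimes> v)"
    by (intro blinfun_eqI)
       (simp add: assms blinfun.scaleR_left blinfun.sum_left tens_apply oproj_orthonormal_expansion[OF _ B(1-3)])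
  moreover have "tensor_trace (\<Sum>v\<in>B. v \<otimes> v) = (\<Sum>v\<in>B. 1)"
    using B(2) by (simp add: linear_sum[OF linear_tensor_trace] tensor_trace_tens dot_square_norm)
  ultimately show ?thesis by (simp add: linear_cmul[OF linear_tensor_trace] B(4))
qed

text \<open>Contracting the last two factors kills the trace-free summand and sends \<open>z \<otimes> oproj V\<close> to
  \<open>dim V\<close> times \<open>z\<close>.\<close>
lemma trace_tracefree_disjoint:
  fixes V :: "'a::euclidean_space set"
  assumes "subspace V" "dim V > 0" "T \<in> trace_summand V" "T \<in> tracefree_summand V"
  shows "T = 0"
proof -
  obtain z where z: "\<And>y v. blinfun_apply (blinfun_apply T y) v = (y \<bullet> z) *\<^sub>R oproj V v"
    using assms trace_summand_iff by blast
  have "(y \<bullet> z) * dim V = 0" for y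
    using tracefree_summand_trace[OF assms(4)] tensor_trace_oproj[OF assms(1) z, of y] by simp
  with assms(2) have "y \<bullet> z = 0" for y by (metis mult_eq_0_iff of_nat_eq_0_iff less_irrefl)
  then show ?thesis by (intro blinfun_eqI) (simp add: z)
qed

text \<open>The two assumptions on \<open>T\<close> say that it lies in \<open>V\<^sup>\<bottom> \<otimes> V \<otimes> V\<close>. The trace-free part is obtained by
  expanding \<open>T\<close> along an orthonormal basis of \<open>V\<^sup>\<bottom>\<close> and removing from each coefficient, an element of
  \<open>V \<otimes> V\<close>, its trace divided by \<open>dim V\<close> times the projection onto \<open>V\<close>.\<close>
lemma trace_tracefree_decomposition:
  fixes V :: "'a::euclidean_space set"
  assumes V: "subspace V" "dim V > 0"
    and T: "\<And>y v. blinfun_apply (blinfun_apply T y) v \<in> V"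
      "\<And>y v. blinfun_apply (blinfun_apply T (oproj (V\<^sup>\<bottom>) y)) (oproj V v) = blinfun_apply (blinfun_apply T y) v"
  obtains T' where "T' \<in> tracefree_summand V" "T - T' \<in> trace_summand V"
proof -
  obtain B where B: "B \<subseteq> V" "pairwise orthogonal B" "\<forall>v\<in>B. norm v = 1" "span B = V" "card B = dim V"
    using orthonormal_basis_subspace[OF V(1)] by metis
  obtain C where C: "C \<subseteq> V\<^sup>\<bottom>" "pairwise orthogonal C" "\<forall>v\<in>C. norm v = 1" "span C = V\<^sup>\<bottom>"
    using orthonormal_basis_subspace[OF subspace_orthogonal_comp] by metis
  note sumB = oproj_orthonormal_expansion[OF V(1) B(2-4)]
  note sumC = oproj_orthonormal_expansion[OF subspace_orthogonal_comp C(2-4)]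
  have idem: "oproj V (oproj V v) = oproj V v" "oproj (V\<^sup>\<bottom>) (oproj (V\<^sup>\<bottom>) v) = oproj (V\<^sup>\<bottom>) v" for v
    using oproj_in V(1) subspace_orthogonal_comp by (metis oproj_eq_self_iff)+
  have T_oproj: "blinfun_apply (blinfun_apply T y) (oproj V v) = blinfun_apply (blinfun_apply T y) v"
    "blinfun_apply (blinfun_apply T (oproj (V\<^sup>\<bottom>) y)) v = blinfun_apply (blinfun_apply T y) v" for y v
    using T(2)[of y v] T(2)[of y "oproj V v"] T(2)[of "oproj (V\<^sup>\<bottom>) y" v] by (simp_all add: idem)
  define Pi where "Pi = (\<Sum>v\<in>B. v \<otimes> v)"
  have Pi_apply: "blinfun_apply Pi x = oproj V x" for x
    by (simp add: Pi_def blinfun.sum_left tens_apply sumB)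
  define t where "t c = tensor_trace (blinfun_apply T c) / dim V" for c
  define T' where "T' = (\<Sum>c\<in>C. c \<otimes> (blinfun_apply T c - t c *\<^sub>R Pi))"
  have T_sum: "(\<Sum>v\<in>B. v \<otimes> blinfun_apply (blinfun_apply T c) v) = blinfun_apply T c" for c
    by (intro blinfun_eqI)
       (simp add: blinfun.sum_left tens_apply sumB T_oproj flip: blinfun.scaleR_right blinfun.sum_right)
  have "blinfun_apply T c \<in> tensor_prod V V" for c
    unfolding tensor_prod_def using B(1) T(1)
    by (subst T_sum[of c, symmetric], intro span_sum span_base) blast
  moreover have "Pi \<in> tensor_prod V V"
    unfolding tensor_prod_def Pi_def using B(1) by (intro span_sum span_base) blast
  ultimately have "blinfun_apply T c - t c *\<^sub>R Pi \<in> tensor_prod V V" for c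
    unfolding tensor_prod_def by (intro span_diff span_scale)
  moreover have "tensor_trace (blinfun_apply T c - t c *\<^sub>R Pi) = 0" for c
    using tensor_trace_oproj[OF V(1), of Pi 1] V(2)
    by (simp add: linear_diff[OF linear_tensor_trace] linear_cmul[OF linear_tensor_trace] Pi_apply t_def
        del: dim_eq_0)
  ultimately have tracefree: "T' \<in> tracefree_summand V"
    unfolding T'_def tracefree_summand_def using C(1)
    by (subst tensor_prod_def) (intro span_sum span_base, blast)
  have "blinfun_apply (blinfun_apply (T - T') y) v
      = (y \<bullet> (\<Sum>c\<in>C. t c *\<^sub>R c)) *\<^sub>R oproj V v" for y v
  proof -
    have "blinfun_apply (blinfun_apply T' y) v
        = (\<Sum>c\<in>C. (y \<bullet> c) *\<^sub>R blinfun_apply (blinfun_apply T c) v) - (\<Sum>c\<in>C. ((y \<bullet> c) * t c) *\<^sub>R oproj V v)"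
      by (simp add: T'_def blinfun.sum_left tens_apply blinfun.diff_left blinfun.scaleR_left Pi_apply
          scaleR_diff_right sum_subtractf)
    also have "(\<Sum>c\<in>C. (y \<bullet> c) *\<^sub>R blinfun_apply (blinfun_apply T c) v)
        = blinfun_apply (blinfun_apply T (\<Sum>c\<in>C. (y \<bullet> c) *\<^sub>R c)) v"
      by (simp add: blinfun.sum_right blinfun.sum_left blinfun.scaleR_right blinfun.scaleR_left)
    finally show ?thesis
      by (simp add: sumC T_oproj blinfun.diff_left inner_sum_right scaleR_sum_left mult.commute)
  qed
  moreover have "(\<Sum>c\<in>C. t c *\<^sub>R c) \<in> V\<^sup>\<bottom>"
    unfolding C(4)[symmetric] by (intro span_sum span_scale span_base)
  ultimately have "T - T' \<in> trace_summand V"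
    unfolding trace_summand_iff[OF V(1)] by (intro bexI[of _ "\<Sum>c\<in>C. t c *\<^sub>R c"]) simp_all
  with tracefree show thesis using that by blast
qed

lemma trace_summand_diff:
  fixes V :: "'a::euclidean_space set"
  assumes "subspace V" "S \<in> trace_summand V" "T \<in> trace_summand V"
  shows "S - T \<in> trace_summand V"
proof -
  obtain y z where "y \<in> V\<^sup>\<bottom>" "\<forall>x v. blinfun_apply (blinfun_apply S x) v = (x \<bullet> y) *\<^sub>R oproj V v"
    and "z \<in> V\<^sup>\<bottom>" "\<forall>x v. blinfun_apply (blinfun_apply T x) v = (x \<bullet> z) *\<^sub>R oproj V v"
    using assms trace_summand_iff by metis
  then show ?thesis unfolding trace_summand_iff[OF assms(1)]
    by (intro bexI[of _ "y - z"])
       (auto simp: blinfun.diff_left inner_diff_right scaleR_diff_left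
          intro: subspace_diff subspace_orthogonal_comp)
qed

text \<open>The decomposition exists and is unique, so the definite description in the definition of
  \<open>pi2\<close> denotes the trace-free part; it vanishes exactly on the trace summand.\<close>
lemma pi2_eq_0_iff:
  fixes V :: "'a::euclidean_space set"
  assumes V: "subspace V" "dim V > 0"
    and T: "\<And>y v. blinfun_apply (blinfun_apply T y) v \<in> V"
      "\<And>y v. blinfun_apply (blinfun_apply T (oproj (V\<^sup>\<bottom>) y)) (oproj V v) = blinfun_apply (blinfun_apply T y) v"
  shows "pi2 V T = 0 \<longleftrightarrow> T \<in> trace_summand V"
proof -
  obtain T' where T': "T' \<in> tracefree_summand V" "T - T' \<in> trace_summand V"
    using trace_tracefree_decomposition[OF V T] .
  have unique: "S = T'" if "S \<in> tracefree_summand V" "T - S \<in> trace_summand V" for S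
  proof -
    have "S - T' \<in> tracefree_summand V"
      using that T' by (simp add: tracefree_summand_def tensor_prod_def span_diff)
    moreover have "(T - T') - (T - S) \<in> trace_summand V"
      using that T' V trace_summand_diff by blast
    ultimately show ?thesis using trace_tracefree_disjoint[OF V, of "S - T'"] by simp
  qed
  have pi2: "pi2 V T = T'"
    unfolding pi2_def by (rule the_equality) (use T' unique in blast)+
  have "0 \<in> tracefree_summand V" by (simp add: tracefree_summand_def tensor_prod_def span_zero)
  then have "T' = 0" if "T \<in> trace_summand V" using unique[of 0] that by simp
  moreover have "T \<in> trace_summand V" if "T' = 0" using T'(2) that by simp
  ultimately show ?thesis unfolding pi2 by blast
qed

section \<open>The covariant derivative and the twistor operator\<close>

lemma subspace_fst_grassmannian:
  assumes "(P :: ('a::euclidean_space, 'k::finite) oplane) \<in> oriented_grassmannian"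
  shows "subspace (fst P)" "dim (fst P) = CARD('k)"
  using assms by (auto simp: oriented_grassmannian_def)

lemma graph_chart_grassmannian:
  assumes "P \<in> oriented_grassmannian"
  shows "graph_chart P L \<in> oriented_grassmannian"
  using assms graph_chart_frame_plane unfolding oriented_grassmannian_frames by fastforce

lemma graph_chart_0:
  assumes "P \<in> oriented_grassmannian"
  shows "graph_chart P 0 = P"
proof -
  obtain b where b: "is_frame b" "P = frame_plane b"
    using assms oriented_grassmannian_frames by auto
  have "graph_map (span (range (($) b))) 0 v = v" for v
    by (simp add: graph_map_def linear_0[OF linear_oproj] subspace_orthogonal_comp)
  then show ?thesis using graph_chart_frame_plane(1)[OF b(1), of 0] b(2) by simp
qed

lemma Cm_const_minus: "Cm m f \<Longrightarrow> Cm m (\<lambda>x. c - f x)"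
proof (induction m arbitrary: c f)
  case 0
  then show ?case by (auto intro: continuous_intros)
next
  case (Suc m)
  have "frechet_derivative (\<lambda>x. c - f x) (at x) = (\<lambda>v. 0 - frechet_derivative f (at x) v)" for x
    using Suc.prems
    by (intro frechet_derivative_at[symmetric] has_derivative_diff has_derivative_const)
       (simp add: frechet_derivative_works)
  then show ?case using Suc.IH[of "\<lambda>x. frechet_derivative f (at x) _" 0] Suc.prems by (auto intro: derivative_intros)
qed

lemma flat_deriv_has_derivative:
  assumes "smooth_on_grassmannian s" "P \<in> oriented_grassmannian"
  shows "((\<lambda>L. s (graph_chart P L)) has_derivative flat_deriv s P) (at 0)"
proof -
  have "Cm (Suc 0) (\<lambda>L. s (graph_chart P L))"
    using assms unfolding smooth_on_grassmannian_def smooth_def by blast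
  then have "(\<lambda>L. s (graph_chart P L)) differentiable (at 0)" by simp
  then show ?thesis
    unfolding frechet_derivative_works flat_deriv_def[abs_def] .
qed

lemma flat_deriv_curve:
  assumes "smooth_on_grassmannian s" "P \<in> oriented_grassmannian"
    and "(c has_real_derivative 1) (at 0)" "c 0 = 0"
  shows "((\<lambda>\<tau>. s (graph_chart P (c \<tau> *\<^sub>R L))) has_vector_derivative flat_deriv s P L) (at 0)"
proof -
  have "((\<lambda>\<tau>. c \<tau> *\<^sub>R L) has_derivative (\<lambda>x. x *\<^sub>R L)) (at 0)"
    using has_derivative_scaleR_left[OF has_field_derivative_imp_has_derivative[OF assms(3)], of L] by simp
  from diff_chain_at[OF this, of "\<lambda>L. s (graph_chart P L)" "flat_deriv s P"]
  have "((\<lambda>\<tau>. s (graph_chart P (c \<tau> *\<^sub>R L))) has_derivative (\<lambda>x. flat_deriv s P (x *\<^sub>R L))) (at 0)"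
    using flat_deriv_has_derivative[OF assms(1,2)] assms(4) by (simp add: comp_def)
  then show ?thesis
    unfolding has_vector_derivative_def
    using linear_cmul[OF has_derivative_linear[OF flat_deriv_has_derivative[OF assms(1,2)]]] by simp
qed

lemma linear_nabla:
  assumes "smooth_on_grassmannian s" "P \<in> oriented_grassmannian"
  shows "linear (nabla s P)"
  using linear_compose[OF has_derivative_linear[OF flat_deriv_has_derivative[OF assms]]
      linear_oproj[OF subspace_fst_grassmannian(1)[OF assms(2)]]]
  by (simp add: comp_def nabla_def[abs_def])

lemma nabla_inner:
  assumes "P \<in> oriented_grassmannian" "w \<in> fst P"
  shows "nabla s P L \<bullet> w = flat_deriv s P L \<bullet> w"
  using inner_oproj[OF subspace_fst_grassmannian(1)[OF assms(1)] assms(2)] by (simp add: nabla_def)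

text \<open>Both maps under \<open>Blinfun\<close> are linear, because the derivative of a smooth section is, and a linear map
  on a Euclidean space is bounded.\<close>
lemma nabla_tensor_apply:
  assumes "smooth_on_grassmannian s" "P \<in> oriented_grassmannian"
  shows "blinfun_apply (blinfun_apply (nabla_tensor s P) y) v
    = nabla s P (oproj (fst P) v \<otimes> oproj ((fst P)\<^sup>\<bottom>) y)"
proof -
  let ?f = "\<lambda>y v. nabla s P (oproj (fst P) v \<otimes> oproj ((fst P)\<^sup>\<bottom>) y)"
  note V = subspace_fst_grassmannian(1)[OF assms(2)]
  have lin_v: "linear (?f y)" for y
    using linear_compose[OF linear_compose[OF linear_oproj[OF V] linear_tens(1)] linear_nabla[OF assms]]
    by (simp add: comp_def)
  have lin_y: "linear (\<lambda>y. ?f y v)" for v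
    using linear_compose[OF linear_compose[OF linear_oproj[OF subspace_orthogonal_comp] linear_tens(2)]
        linear_nabla[OF assms]]
    by (simp add: comp_def)
  have inner: "blinfun_apply (Blinfun (?f y)) v = ?f y v" for y v
    using lin_v linear_conv_bounded_linear bounded_linear_Blinfun_apply by metis
  have "linear (\<lambda>y. Blinfun (?f y))"
    by (rule linearI; rule blinfun_eqI; simp only: inner blinfun.add_left blinfun.scaleR_left;
        rule linear_add[OF lin_y] linear_cmul[OF lin_y])
  then have "blinfun_apply (nabla_tensor s P) y = Blinfun (?f y)"
    unfolding nabla_tensor_def using linear_conv_bounded_linear bounded_linear_Blinfun_apply by metis
  then show ?thesis by (simp add: inner)
qed

text \<open>The equation \<open>Ds = 0\<close> says that \<open>\<nabla>s\<close> is \<open>z \<otimes> id\<close> for some \<open>z\<close> in the normal fibre: moving the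
  plane in the direction \<open>v \<otimes> y\<close>, which tilts \<open>v\<close> towards \<open>y\<close>, changes the tangential part of the
  section only along \<open>v\<close>.\<close>
lemma twistor_D_eq_0_iff:
  fixes P :: "('a::euclidean_space, 'k::finite) oplane"
  assumes "smooth_on_grassmannian s" "P \<in> oriented_grassmannian"
  shows "twistor_D s P = 0 \<longleftrightarrow>
    (\<exists>z\<in>(fst P)\<^sup>\<bottom>. \<forall>v\<in>fst P. \<forall>y\<in>(fst P)\<^sup>\<bottom>. nabla s P (v \<otimes> y) = (y \<bullet> z) *\<^sub>R v)"
proof -
  note V = subspace_fst_grassmannian[OF assms(2)]
  note W = subspace_orthogonal_comp[of "fst P"]
  note apply_nabla = nabla_tensor_apply[OF assms]
  have idem: "oproj (fst P) (oproj (fst P) v) = oproj (fst P) v"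
    "oproj ((fst P)\<^sup>\<bottom>) (oproj ((fst P)\<^sup>\<bottom>) v) = oproj ((fst P)\<^sup>\<bottom>) v" for v
    by (simp_all add: oproj_eq_self_iff oproj_in V W)
  have "twistor_D s P = 0 \<longleftrightarrow> nabla_tensor s P \<in> trace_summand (fst P)"
    unfolding twistor_D_def using V(2)
    by (intro pi2_eq_0_iff V(1)) (simp_all add: apply_nabla idem nabla_def oproj_in V(1) del: dim_eq_0)
  also have "\<dots> \<longleftrightarrow> (\<exists>z\<in>(fst P)\<^sup>\<bottom>. \<forall>y v. nabla s P (oproj (fst P) v \<otimes> oproj ((fst P)\<^sup>\<bottom>) y)
      = (y \<bullet> z) *\<^sub>R oproj (fst P) v)"
    unfolding trace_summand_iff[OF V(1)] apply_nabla ..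
  also have "\<dots> \<longleftrightarrow> (\<exists>z\<in>(fst P)\<^sup>\<bottom>. \<forall>v\<in>fst P. \<forall>y\<in>(fst P)\<^sup>\<bottom>. nabla s P (v \<otimes> y) = (y \<bullet> z) *\<^sub>R v)"
  proof (rule bex_cong[OF refl])
    fix z assume z: "z \<in> (fst P)\<^sup>\<bottom>"
    show "(\<forall>y v. nabla s P (oproj (fst P) v \<otimes> oproj ((fst P)\<^sup>\<bottom>) y) = (y \<bullet> z) *\<^sub>R oproj (fst P) v)
      \<longleftrightarrow> (\<forall>v\<in>fst P. \<forall>y\<in>(fst P)\<^sup>\<bottom>. nabla s P (v \<otimes> y) = (y \<bullet> z) *\<^sub>R v)" (is "?l \<longleftrightarrow> ?r")
    proof
      assume ?l
      then show ?r using oproj_eq_self_iff[OF V(1)] oproj_eq_self_iff[OF W] by metis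
    next
      assume ?r
      then show ?l using oproj_in(1)[OF V(1)] oproj_in(1)[OF W] inner_oproj[OF W z] by simp
    qed
  qed
  finally show ?thesis .
qed

section \<open>Rotating a plane about a hyperplane\<close>

definition set_at :: "'a ^ 'k \<Rightarrow> 'k \<Rightarrow> 'a \<Rightarrow> 'a ^ 'k" where
  "set_at b j x = (\<chi> i. if i = j then x else b $ i)"

lemma range_set_at: "range (($) (set_at b j x)) = insert x (($) b ` (- {j}))"
  by (auto simp: set_at_def image_iff)

lemma is_frame_set_at:
  assumes "inj_on (($) b) (- {j})" "independent (($) b ` (- {j}))" "x \<notin> span (($) b ` (- {j}))"
  shows "is_frame (set_at b j x)"
proof -
  have "inj (($) (set_at b j x))"
  proof (rule injI)
    fix i l assume "set_at b j x $ i = set_at b j x $ l"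
    then show "i = l"
      using assms(1,3) span_base[of _ "($) b ` (- {j})"]
      by (auto simp: set_at_def inj_on_def split: if_splits)
  qed
  moreover have "independent (range (($) (set_at b j x)))"
    unfolding range_set_at using assms(2,3) by (simp add: independent_insert)
  ultimately show ?thesis by (simp add: frames_def)
qed

lemma frame_plane_set_at_scale:
  assumes "is_frame (set_at b j x)" "c > 0"
  shows "frame_plane (set_at b j (c *\<^sub>R x)) = frame_plane (set_at b j x)"
proof -
  have "set_at b j (c *\<^sub>R x) = rebase (scale_at j c) (set_at b j x)"
    by (simp add: vec_eq_iff rebase_scale_at set_at_def)
  then show ?thesis using frame_plane_rebase[OF assms(1)] assms(2) by (simp add: det_scale_at)
qed

text \<open>Tilting the plane \<open>U + \<real> x\<close> along \<open>x \<otimes> y\<close> fixes \<open>U\<close> and replaces \<open>x\<close> by \<open>x + c y\<close>.\<close>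
lemma graph_chart_set_at:
  assumes U: "inj_on (($) b) (- {j})" "independent (($) b ` (- {j}))" "U = span (($) b ` (- {j}))"
    and x: "x \<in> U\<^sup>\<bottom>" "norm x = 1" and y: "y \<in> U\<^sup>\<bottom>" "x \<bullet> y = 0"
  shows "graph_chart (frame_plane (set_at b j x)) (c *\<^sub>R (x \<otimes> y)) = frame_plane (set_at b j (x + c *\<^sub>R y))"
proof -
  let ?V = "span (range (($) (set_at b j x)))"
  have "x \<notin> U"
    using x by (auto simp: orthogonal_comp_iff)
  then have frame: "is_frame (set_at b j x)" using U is_frame_set_at by blast
  have "u \<bullet> y = 0" if "u \<in> ?V" for u
  proof -
    have "orthogonal y u"
      using that
    proof (rule orthogonal_to_span)
      fix v assume "v \<in> range (($) (set_at b j x))"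
      then show "orthogonal y v"
        using x y U(3) span_base[of v "($) b ` (- {j})"]
        unfolding range_set_at orthogonal_comp_iff orthogonal_def by (auto simp: inner_commute)
    qed
    then show ?thesis by (simp add: orthogonal_def inner_commute)
  qed
  then have y_perp: "oproj (?V\<^sup>\<bottom>) y = y"
    by (simp add: oproj_eq_self_iff subspace_orthogonal_comp orthogonal_comp_iff)
  have "graph_map ?V (c *\<^sub>R (x \<otimes> y)) v = v + (c * (v \<bullet> x)) *\<^sub>R y" for v
    by (simp add: graph_map_def blinfun.scaleR_left tens_apply y_perp
        linear_cmul[OF linear_oproj] subspace_orthogonal_comp)
  moreover have "b $ i \<bullet> x = 0" if "i \<noteq> j" for i
    using x(1) U(3) that span_base[of "b $ i" "($) b ` (- {j})"] by (auto simp: orthogonal_comp_iff)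
  ultimately have "(\<chi> i. graph_map ?V (c *\<^sub>R (x \<otimes> y)) (set_at b j x $ i)) = set_at b j (x + c *\<^sub>R y)"
    using x(2) by (simp add: vec_eq_iff set_at_def dot_square_norm)
  then show ?thesis using graph_chart_frame_plane(1)[OF frame] by simp
qed

text \<open>The plane \<open>U + \<real> x(t)\<close> with \<open>x(t) = cos t e + sin t g\<close> moves at each time in the direction
  \<open>x(t) \<otimes> x'(t)\<close>. If \<open>Ds = 0\<close>, the section then changes, up to normal vectors, by a multiple of
  \<open>x(t)\<close>, which is orthogonal to \<open>U\<close>. Hence its inner product with a vector of \<open>U\<close> is constant. In the
  graph chart at time \<open>t\<close> the motion reads \<open>\<tau> \<mapsto> tan \<tau> (x(t) \<otimes> x'(t))\<close>, since
  \<open>x(t + \<tau>) = cos \<tau> (x(t) + tan \<tau> x'(t))\<close> and positive factors do not change the oriented plane.\<close>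
lemma inner_section_const_rotation:
  fixes s :: "('a::euclidean_space, 'k::finite) oplane \<Rightarrow> 'a"
  assumes s: "smooth_on_grassmannian s"
    and D: "\<forall>P\<in>oriented_grassmannian. twistor_D s P = 0"
    and U: "inj_on (($) b) (- {j})" "independent (($) b ` (- {j}))" "U = span (($) b ` (- {j}))"
    and w: "w \<in> U"
    and e: "e \<in> U\<^sup>\<bottom>" "norm e = 1" and g: "g \<in> U\<^sup>\<bottom>" "norm g = 1" and eg: "e \<bullet> g = 0"
  shows "s (frame_plane (set_at b j (cos t *\<^sub>R e + sin t *\<^sub>R g))) \<bullet> w = s (frame_plane (set_at b j e)) \<bullet> w"
proof -
  define x where "x t = cos t *\<^sub>R e + sin t *\<^sub>R g" for t
  define x' where "x' t = cos t *\<^sub>R g - sin t *\<^sub>R e" for t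
  define Q where "Q v = frame_plane (set_at b j v)" for v
  have ee: "e \<bullet> e = 1" "g \<bullet> g = 1" "g \<bullet> e = 0"
    using e g eg by (simp_all add: dot_square_norm inner_commute)
  have perp: "x t \<in> U\<^sup>\<bottom>" "x' t \<in> U\<^sup>\<bottom>" for t
    using e g unfolding x_def x'_def
    by (auto intro!: subspace_add subspace_diff subspace_scale subspace_orthogonal_comp)
  have "x t \<bullet> x t = (cos t)\<^sup>2 + (sin t)\<^sup>2" for t
    by (simp add: x_def inner_add_left inner_add_right ee eg power2_eq_square)
  then have norm_x: "norm (x t) = 1" for t by (simp add: norm_eq_1)
  have xx': "x t \<bullet> x' t = 0" for t
    by (simp add: x_def x'_def inner_add_left inner_diff_right ee eg)
  have notin: "v \<notin> U" if "v \<in> U\<^sup>\<bottom>" "v \<noteq> 0" for v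
    using that by (auto simp: orthogonal_comp_iff)
  then have frame: "is_frame (set_at b j v)" if "v \<in> U\<^sup>\<bottom>" "v \<noteq> 0" for v
    using is_frame_set_at U that by blast
  have "((\<lambda>t. s (Q (x t)) \<bullet> w) has_real_derivative 0) (at t)" for t
  proof -
    have "x t \<noteq> 0" using norm_x[of t] by auto
    with frame perp have fr: "is_frame (set_at b j (x t))" by blast
    then have P: "Q (x t) \<in> oriented_grassmannian"
      unfolding Q_def oriented_grassmannian_frames by blast
    have V: "fst (Q (x t)) = span (insert (x t) (($) b ` (- {j})))"
      by (simp add: Q_def fst_frame_plane range_set_at)
    have U_V: "U \<subseteq> fst (Q (x t))" unfolding V U(3) by (intro span_mono) blast
    have x_V: "x t \<in> fst (Q (x t))" unfolding V by (simp add: span_base)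
    have "x' t \<in> (fst (Q (x t)))\<^sup>\<bottom>"
    proof -
      have "orthogonal (x' t) u" if "u \<in> fst (Q (x t))" for u
        using that unfolding V
      proof (rule orthogonal_to_span)
        fix v assume "v \<in> insert (x t) (($) b ` (- {j}))"
        then show "orthogonal (x' t) v"
          using perp(2)[of t] xx'[of t] U(3) span_base[of v "($) b ` (- {j})"]
          by (auto simp: orthogonal_def orthogonal_comp_iff inner_commute)
      qed
      then show ?thesis by (simp add: orthogonal_comp_iff orthogonal_def inner_commute)
    qed
    then obtain z where "nabla s (Q (x t)) (x t \<otimes> x' t) = z *\<^sub>R x t"
      using D P x_V twistor_D_eq_0_iff[OF s P] by blast
    moreover have "x t \<bullet> w = 0" using perp(1)[of t] w by (simp add: orthogonal_comp_iff inner_commute)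
    ultimately have flat: "flat_deriv s (Q (x t)) (x t \<otimes> x' t) \<bullet> w = 0"
      using nabla_inner[OF P, of w] U_V w by (metis inner_scaleR_left mult_zero_right subsetD)
    have chart: "Q (x (\<tau> + t)) = graph_chart (Q (x t)) (tan \<tau> *\<^sub>R (x t \<otimes> x' t))"
      if "\<tau> \<in> {-(pi/2)<..<pi/2}" for \<tau>
    proof -
      have cos: "cos \<tau> > 0" using that by (auto intro: cos_gt_zero_pi)
      have perp': "x t + tan \<tau> *\<^sub>R x' t \<in> U\<^sup>\<bottom>"
        by (intro subspace_add subspace_scale subspace_orthogonal_comp perp)
      have "(x t + tan \<tau> *\<^sub>R x' t) \<bullet> x t = 1"
        using norm_x[of t] xx'[of t] by (simp add: inner_add_left norm_eq_1 inner_commute[of "x' t"])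
      then have "x t + tan \<tau> *\<^sub>R x' t \<noteq> 0" by auto
      with frame perp' have fr': "is_frame (set_at b j (x t + tan \<tau> *\<^sub>R x' t))" by blast
      have "x (\<tau> + t) = cos \<tau> *\<^sub>R x t + sin \<tau> *\<^sub>R x' t"
        by (simp add: x_def x'_def cos_add sin_add scaleR_add_left scaleR_diff_left
            scaleR_add_right scaleR_diff_right algebra_simps)
      also have "\<dots> = cos \<tau> *\<^sub>R (x t + tan \<tau> *\<^sub>R x' t)"
        using cos by (simp add: scaleR_add_right tan_def)
      finally show ?thesis
        using frame_plane_set_at_scale[OF fr' cos]
          graph_chart_set_at[OF U perp(1) norm_x perp(2) xx'] by (simp add: Q_def)
    qed
    have "((\<lambda>\<tau>. s (graph_chart (Q (x t)) (tan \<tau> *\<^sub>R (x t \<otimes> x' t)))) has_vector_derivative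
        flat_deriv s (Q (x t)) (x t \<otimes> x' t)) (at 0)"
      by (rule flat_deriv_curve[OF s P]) (auto intro!: derivative_eq_intros)
    then have "((\<lambda>\<tau>. s (graph_chart (Q (x t)) (tan \<tau> *\<^sub>R (x t \<otimes> x' t))) \<bullet> w) has_vector_derivative
        flat_deriv s (Q (x t)) (x t \<otimes> x' t) \<bullet> w) (at 0)"
      by (rule bounded_linear.has_vector_derivative[OF bounded_linear_inner_left])
    then have "((\<lambda>\<tau>. s (Q (x (\<tau> + t))) \<bullet> w) has_vector_derivative 0) (at 0)"
      unfolding flat
    proof (rule has_vector_derivative_transform_within_open)
      show "open {-(pi/2)<..<pi/2}" "0 \<in> {-(pi/2)<..<pi/2}" by auto
    qed (simp add: chart)
    then show ?thesis
      using DERIV_shift[of "\<lambda>t. s (Q (x t)) \<bullet> w" 0 0 t]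
      by (simp add: has_real_derivative_iff_has_vector_derivative)
  qed
  then have "\<forall>t. ((\<lambda>t. s (Q (x t)) \<bullet> w) has_real_derivative 0) (at t)" by blast
  from DERIV_isconst_all[OF this, of t 0] show ?thesis by (simp add: x_def Q_def)
qed

lemma unit_orthogonal_exists:
  fixes S T :: "'a::euclidean_space set"
  assumes "subspace S" "subspace T" "S \<subseteq> T" "dim S < dim T"
  obtains e where "e \<in> T" "e \<in> S\<^sup>\<bottom>" "norm e = 1"
proof -
  obtain x where x: "x \<in> T" "x \<notin> S" using assms by (meson dim_subset not_le subsetI)
  define y where "y = x - oproj S x"
  have y: "y \<in> T" "y \<in> S\<^sup>\<bottom>" "y \<noteq> 0"
    using x oproj_in[OF assms(1), of x] assms by (auto simp: y_def intro: subspace_diff)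
  then have "(1 / norm y) *\<^sub>R y \<in> T" "(1 / norm y) *\<^sub>R y \<in> S\<^sup>\<bottom>"
    using assms(2) by (simp_all add: subspace_scale subspace_orthogonal_comp)
  then show thesis using that y(3) by simp
qed

lemma subspace_basis_off_index:
  fixes U :: "'a::euclidean_space set"
  assumes "subspace U" "dim U = CARD('k::finite) - 1"
  obtains b :: "'a ^ ('k::finite)" and j where
    "inj_on (($) b) (- {j})" "independent (($) b ` (- {j}))" "U = span (($) b ` (- {j}))"
proof -
  fix j :: 'k
  obtain B where B: "independent B" "span B = U" "card B = dim U" "B \<subseteq> U"
    using assms by (metis basis_exists span_eq_iff span_mono subset_antisym)
  have "finite B" using B(1) independent_imp_finite by blast
  moreover have "card (- {j}) = card B" using assms B by (simp add: Compl_eq_Diff_UNIV card_Diff_singleton)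
  ultimately obtain f where f: "bij_betw f (- {j}) B"
    using finite_same_card_bij[of "- {j}" B] by auto
  define b where "b = (\<chi> i. f i)"
  have "($) b = f" by (auto simp: b_def)
  then show thesis using that[of b j] f B by (simp add: bij_betw_def)
qed

text \<open>An oriented plane containing \<open>U\<close> is \<open>U\<close> together with a unit vector \<open>e\<close> orthogonal to \<open>U\<close>, the sign
  of \<open>e\<close> encoding the orientation. Any two unit vectors of \<open>U\<^sup>\<bottom>\<close>, even opposite ones, are joined by
  a rotation in a plane of \<open>U\<^sup>\<bottom>\<close>, which has dimension at least two because \<open>k < n\<close>.\<close>
lemma inner_section_const_adjacent:
  fixes s :: "('a::euclidean_space, 'k::finite) oplane \<Rightarrow> 'a"
  assumes s: "smooth_on_grassmannian s"
    and D: "\<forall>P\<in>oriented_grassmannian. twistor_D s P = 0"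
    and n: "CARD('k) < DIM('a)"
    and P: "P \<in> oriented_grassmannian" "P' \<in> oriented_grassmannian"
    and U: "subspace U" "dim U = CARD('k) - 1" "U \<subseteq> fst P" "U \<subseteq> fst P'" and w: "w \<in> U"
  shows "s P \<bullet> w = s P' \<bullet> w"
proof -
  obtain b :: "'a ^ 'k" and j where
    b: "inj_on (($) b) (- {j})" "independent (($) b ` (- {j}))" "U = span (($) b ` (- {j}))"
    using subspace_basis_off_index[OF U(1,2)] .
  define Q where "Q v = frame_plane (set_at b j v)" for v
  have rotation: "s (Q e) \<bullet> w = s (Q e') \<bullet> w"
    if e: "e \<in> U\<^sup>\<bottom>" "norm e = 1" and e': "e' \<in> U\<^sup>\<bottom>" "norm e' = 1" for e e'
  proof -
    have "\<exists>g t. g \<in> U\<^sup>\<bottom> \<and> norm g = 1 \<and> e \<bullet> g = 0 \<and> e' = cos t *\<^sub>R e + sin t *\<^sub>R g"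
    proof -
      define c where "c = e' \<bullet> e"
      define r where "r = e' - c *\<^sub>R e"
      have r: "r \<in> U\<^sup>\<bottom>" "e \<bullet> r = 0"
        using e e' by (auto simp: r_def c_def inner_diff_right inner_commute dot_square_norm
            intro: subspace_diff subspace_scale subspace_orthogonal_comp)
      \<comment> \<open>If \<open>e'\<close> is \<open>e\<close> or \<open>- e\<close>, the plane of rotation is not determined and any \<open>g\<close> will do.\<close>
      obtain g where g: "g \<in> U\<^sup>\<bottom>" "norm g = 1" "e \<bullet> g = 0" "r = norm r *\<^sub>R g"
      proof (cases "r = 0")
        case True
        have "dim (span (insert e U)) \<le> dim U + 1" by (simp add: dim_insert)
        also have "\<dots> < DIM('a)" using U(2) n by simp
        finally obtain g where "g \<in> (span (insert e U))\<^sup>\<bottom>" "norm g = 1"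
          using unit_orthogonal_exists[of "span (insert e U)" UNIV] by auto
        moreover have "insert e U \<subseteq> span (insert e U)" by (rule span_superset)
        ultimately show ?thesis using True that[of g] by (auto simp: orthogonal_comp_iff)
      next
        case False
        then show ?thesis using r that[of "(1 / norm r) *\<^sub>R r"]
          by (simp add: subspace_scale subspace_orthogonal_comp)
      qed
      have e'_eq: "e' = c *\<^sub>R e + norm r *\<^sub>R g" using g(4) by (simp add: r_def)
      have "e' \<bullet> e' = c\<^sup>2 + (norm r)\<^sup>2"
      proof -
        have "e \<bullet> e = 1" "g \<bullet> g = 1" "g \<bullet> e = 0"
          using e g by (simp_all add: dot_square_norm inner_commute)
        then show ?thesis
          using g(3) by (simp add: e'_eq inner_add_left inner_add_right power2_eq_square)
      qed
      then have "c\<^sup>2 + (norm r)\<^sup>2 = 1" using e'(2) by (simp add: dot_square_norm)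
      then obtain t where "c = cos t" "norm r = sin t" using sincos_total_2pi by metis
      with e'_eq g show ?thesis by metis
    qed
    then show ?thesis
      using inner_section_const_rotation[OF s D b w e] unfolding Q_def by metis
  qed
  have "\<exists>e. e \<in> U\<^sup>\<bottom> \<and> norm e = 1 \<and> R = Q e" if R: "R \<in> oriented_grassmannian" "U \<subseteq> fst R" for R
  proof -
    note V = subspace_fst_grassmannian[OF R(1)]
    have "dim U < dim (fst R)" using V U by simp
    then obtain e where e: "e \<in> fst R" "e \<in> U\<^sup>\<bottom>" "norm e = 1"
      using unit_orthogonal_exists[of U "fst R"] U(1) R(2) V(1) by blast
    have "e \<notin> U" using e by (auto simp: orthogonal_comp_iff)
    then have fr: "is_frame (set_at b j e)" using is_frame_set_at b by blast
    let ?V = "span (range (($) (set_at b j e)))"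
    have "?V \<subseteq> fst R"
      using e R(2) V unfolding range_set_at b(3)
      by (intro span_minimal) (auto intro: span_base)
    moreover have "dim ?V = CARD('k)"
      using fr by (simp add: frames_def dim_eq_card_independent card_image)
    ultimately have VR: "?V = fst R"
      using V subspace_dim_equal[of ?V "fst R"] by simp
    obtain c where c: "is_frame c" "R = frame_plane c"
      using R(1) oriented_grassmannian_frames by auto
    have "set_at b j e \<in> frames (fst R)" "c \<in> frames (fst R)"
      using fr c VR by (simp_all add: fst_frame_plane)
    moreover have "rebase (scale_at j (-1)) (set_at b j e) = set_at b j (- e)"
      by (simp add: vec_eq_iff rebase_scale_at set_at_def)
    ultimately have "Q e = R \<or> Q (- e) = R"
      using frame_plane_cases[of c "fst R" "set_at b j e" j] c by (simp add: Q_def)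
    moreover have "- e \<in> U\<^sup>\<bottom>" using e by (simp add: orthogonal_comp_iff)
    ultimately show ?thesis using e by (metis norm_minus_cancel)
  qed
  then show ?thesis using rotation P U by metis
qed

section \<open>Parallel components determine a constant vector\<close>

text \<open>Two planes containing \<open>w\<close> are joined by a chain of planes containing \<open>w\<close> in which neighbours
  share a hyperplane through \<open>w\<close>. A first link is built by keeping a hyperplane of the first plane that
  contains the intersection and adding a new vector of the second; this raises the dimension of the
  intersection. When the intersection has dimension at least \<open>k - 1\<close>, a hyperplane through \<open>w\<close>
  can be chosen inside it as \<open>k > 1\<close>; this also covers two orientations of the same subspace.\<close>
lemma inner_section_const:
  fixes s :: "('a::euclidean_space, 'k::finite) oplane \<Rightarrow> 'a"
  assumes s: "smooth_on_grassmannian s"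
    and D: "\<forall>P\<in>oriented_grassmannian. twistor_D s P = 0"
    and n: "CARD('k) > 1" "CARD('k) < DIM('a)"
    and P: "P \<in> oriented_grassmannian" "P' \<in> oriented_grassmannian"
    and w: "w \<in> fst P" "w \<in> fst P'"
  shows "s P \<bullet> w = s P' \<bullet> w"
  using P(1) w(1)
proof (induction "CARD('k) - dim (fst P \<inter> fst P')" arbitrary: P rule: less_induct)
  case less
  note V = subspace_fst_grassmannian[OF less.prems(1)]
  note V' = subspace_fst_grassmannian[OF P(2)]
  let ?I = "fst P \<inter> fst P'"
  have I: "subspace ?I" using V V' by (simp add: subspace_inter)
  have dim_w: "dim (span {w}) \<le> 1" using dim_le_card'[of "{w}"] by simp
  show ?case
  proof (cases "CARD('k) - 1 \<le> dim ?I")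
    case True
    have "dim (span {w}) \<le> CARD('k) - 1" using dim_w n(1) by linarith
    moreover have "span {w} \<subseteq> ?I" using less.prems w I by (intro span_minimal) auto
    ultimately obtain U where "subspace U" "span {w} \<subseteq> U" "U \<subseteq> ?I" "dim U = CARD('k) - 1"
      using subspace_between[of "span {w}" ?I "CARD('k) - 1"] True I subspace_span by metis
    then show ?thesis
      using inner_section_const_adjacent[OF s D n(2) less.prems(1) P(2), of U w] span_base[of w "{w}"] by auto
  next
    case False
    obtain U where U: "subspace U" "?I \<subseteq> U" "U \<subseteq> fst P" "dim U = CARD('k) - 1"
      using subspace_between[of ?I "fst P" "CARD('k) - 1"] False I V by auto
    have "\<not> fst P' \<subseteq> fst P"
    proof
      assume "fst P' \<subseteq> fst P"
      then have "?I = fst P'" by blast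
      with False V' show False by simp
    qed
    then obtain x where x: "x \<in> fst P'" "x \<notin> fst P" by blast
    have "dim (span (insert x U)) = CARD('k)"
    proof -
      have "x \<notin> span U" using x U span_eq_iff[of U] by blast
      then show ?thesis using U(4) n(1) by (simp add: dim_insert)
    qed
    then obtain R :: "('a, 'k) oplane" where R: "R \<in> oriented_grassmannian" "fst R = span (insert x U)"
      using oriented_plane_exists by (metis subspace_span)
    have UR: "insert x U \<subseteq> fst R" unfolding R(2) by (rule span_superset)
    have wU: "w \<in> U" using less.prems w U by blast
    have sub: "span (insert x ?I) \<subseteq> fst R \<inter> fst P'"
      using UR U(2) x(1) R V' by (intro span_minimal) (auto simp: subspace_inter)
    have "dim (span (insert x ?I)) = dim ?I + 1"
    proof -
      have "x \<notin> span ?I" using x I span_eq_iff[of ?I] by blast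
      then show ?thesis by (simp add: dim_insert)
    qed
    with dim_subset[OF sub] have "dim ?I < dim (fst R \<inter> fst P')" by linarith
    with False have "CARD('k) - dim (fst R \<inter> fst P') < CARD('k) - dim ?I" by linarith
    then have "s R \<bullet> w = s P' \<bullet> w"
      using less.hyps R(1) wU UR by blast
    moreover have "s P \<bullet> w = s R \<bullet> w"
      using inner_section_const_adjacent[OF s D n(2) less.prems(1) R(1) U(1,4,3) _ wU] UR by auto
    ultimately show ?thesis by simp
  qed
qed


text \<open>The value \<open>h w = s P \<bullet> w\<close> is the same for all planes \<open>P\<close> through \<open>w\<close>. It is linear in \<open>w\<close> on each
  plane, and two vectors always lie in a common plane as \<open>k > 1\<close>. So \<open>h\<close> is a linear functional
  and is represented by a vector \<open>A\<close>.\<close>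
lemma section_is_projection:
  fixes s :: "('a::euclidean_space, 'k::finite) oplane \<Rightarrow> 'a"
  assumes s: "smooth_on_grassmannian s"
    and D: "\<forall>P\<in>oriented_grassmannian. twistor_D s P = 0"
    and n: "CARD('k) > 1" "CARD('k) < DIM('a)"
  obtains A where "\<And>P w. P \<in> oriented_grassmannian \<Longrightarrow> w \<in> fst P \<Longrightarrow> s P \<bullet> w = A \<bullet> w"
proof -
  have common: "\<exists>P :: ('a, 'k) oplane. P \<in> oriented_grassmannian \<and> v \<in> fst P \<and> w \<in> fst P" for v w
  proof -
    have "card {v, w} \<le> 2" by (cases "v = w") auto
    then have "dim (span {v, w}) \<le> CARD('k)" using dim_le_card'[of "{v, w}"] n by simp
    then obtain V where "subspace V" "span {v, w} \<subseteq> V" "dim V = CARD('k)"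
      using subspace_between[of "span {v, w}" UNIV "CARD('k)"] n by (auto simp del: dim_span)
    moreover have "{v, w} \<subseteq> span {v, w}" by (rule span_superset)
    moreover obtain P :: "('a, 'k) oplane" where "P \<in> oriented_grassmannian" "fst P = V"
      using oriented_plane_exists calculation by metis
    ultimately show ?thesis by blast
  qed
  define h where "h w = s (SOME P. P \<in> oriented_grassmannian \<and> w \<in> fst P) \<bullet> w" for w
  have h: "s P \<bullet> w = h w" if "P \<in> oriented_grassmannian" "w \<in> fst P" for P w
  proof -
    have "(SOME P :: ('a, 'k) oplane. P \<in> oriented_grassmannian \<and> w \<in> fst P) \<in> oriented_grassmannian
      \<and> w \<in> fst (SOME P :: ('a, 'k) oplane. P \<in> oriented_grassmannian \<and> w \<in> fst P)"
      by (rule someI) (use that in blast)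
    then show ?thesis unfolding h_def using inner_section_const[OF s D n that(1) _ that(2)] by blast
  qed
  have "linear h"
  proof (rule linearI)
    fix v w :: 'a and c :: real
    obtain P :: "('a, 'k) oplane" where P: "P \<in> oriented_grassmannian" "v \<in> fst P" "w \<in> fst P"
      using common by blast
    then have "v + w \<in> fst P" "c *\<^sub>R v \<in> fst P"
      using subspace_fst_grassmannian(1)[OF P(1)] by (auto intro: subspace_add subspace_scale)
    then show "h (v + w) = h v + h w" "h (c *\<^sub>R v) = c *\<^sub>R h v"
      using P by (simp_all add: h[symmetric] inner_add_right flip: h[OF P(1)])
  qed
  have "h w = (\<Sum>b\<in>Basis. h b *\<^sub>R b) \<bullet> w" for w
  proof -
    have "h w = h (\<Sum>b\<in>Basis. (w \<bullet> b) *\<^sub>R b)" by (simp add: euclidean_representation)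
    then show ?thesis
      by (simp add: linear_sum[OF \<open>linear h\<close>] linear_cmul[OF \<open>linear h\<close>] inner_sum_left
          inner_commute[of w] mult.commute)
  qed
  then show thesis using that h by metis
qed

text \<open>Differentiate at \<open>\<tau> = 0\<close> the identity \<open>s(P\<^sub>\<tau>) \<bullet> w\<^sub>\<tau> = A \<bullet> w\<^sub>\<tau>\<close>, where \<open>P\<^sub>\<tau>\<close> is the graph of
  \<open>\<tau> (v \<otimes> y)\<close> and \<open>w\<^sub>\<tau> = w + \<tau> (w \<bullet> v) y\<close> is the vector of that graph above \<open>w\<close>. The derivative of
  \<open>w\<^sub>\<tau>\<close> is normal, so it does not pair with \<open>s(P)\<close>.\<close>
lemma nabla_projection_of_constant:
  fixes s :: "('a::euclidean_space, 'k::finite) oplane \<Rightarrow> 'a"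
  assumes s: "s \<in> sections_taut"
    and A: "\<And>P w. P \<in> oriented_grassmannian \<Longrightarrow> w \<in> fst P \<Longrightarrow> s P \<bullet> w = A \<bullet> w"
    and P: "P \<in> oriented_grassmannian" and v: "v \<in> fst P" and y: "y \<in> (fst P)\<^sup>\<bottom>"
  shows "nabla s P (v \<otimes> y) = (y \<bullet> A) *\<^sub>R v"
proof -
  note V = subspace_fst_grassmannian(1)[OF P]
  have smooth: "smooth_on_grassmannian s" and s_V: "s P \<in> fst P"
    using s P by (auto simp: sections_taut_def)
  have inner: "nabla s P (v \<otimes> y) \<bullet> w = (y \<bullet> A) * (v \<bullet> w)" if w: "w \<in> fst P" for w
  proof -
    let ?f = "\<lambda>\<tau>::real. s (graph_chart P (\<tau> *\<^sub>R (v \<otimes> y)))"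
    let ?w = "\<lambda>\<tau>::real. w + \<tau> *\<^sub>R ((w \<bullet> v) *\<^sub>R y)"
    have "graph_map (fst P) (\<tau> *\<^sub>R (v \<otimes> y)) w = ?w \<tau>" for \<tau>
      using y oproj_eq_self_iff[OF subspace_orthogonal_comp, of "fst P" y]
      by (simp add: graph_map_def blinfun.scaleR_left tens_apply
          linear_cmul[OF linear_oproj] subspace_orthogonal_comp)
    then have "?w \<tau> \<in> fst (graph_chart P (\<tau> *\<^sub>R (v \<otimes> y)))" for \<tau>
      using w by (metis fst_conv graph_chart_def image_eqI)
    then have eq: "?f \<tau> \<bullet> ?w \<tau> = A \<bullet> ?w \<tau>" for \<tau>
      using A graph_chart_grassmannian[OF P] by blast
    have f: "(?f has_vector_derivative flat_deriv s P (v \<otimes> y)) (at 0)"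
      by (rule flat_deriv_curve[OF smooth P]) auto
    have w': "(?w has_vector_derivative (w \<bullet> v) *\<^sub>R y) (at 0)"
      by (auto intro!: derivative_eq_intros)
    have "((\<lambda>\<tau>. ?f \<tau> \<bullet> ?w \<tau>) has_vector_derivative
        (?f 0 \<bullet> (w \<bullet> v) *\<^sub>R y + flat_deriv s P (v \<otimes> y) \<bullet> ?w 0)) (at 0)"
      by (rule bounded_bilinear.has_vector_derivative[OF bounded_bilinear_inner f w'])
    moreover have "((\<lambda>\<tau>. A \<bullet> ?w \<tau>) has_vector_derivative A \<bullet> (w \<bullet> v) *\<^sub>R y) (at 0)"
      by (rule bounded_linear.has_vector_derivative[OF bounded_linear_inner_right w'])
    ultimately have "?f 0 \<bullet> (w \<bullet> v) *\<^sub>R y + flat_deriv s P (v \<otimes> y) \<bullet> ?w 0 = A \<bullet> (w \<bullet> v) *\<^sub>R y"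
      unfolding eq by (rule vector_derivative_unique_at)
    moreover have "s P \<bullet> y = 0" using y s_V by (simp add: orthogonal_comp_iff)
    ultimately show ?thesis
      using graph_chart_0[OF P] nabla_inner[OF P w] by (simp add: inner_commute mult.commute)
  qed
  \<comment> \<open>Both sides lie in the plane, where a vector is determined by its inner products.\<close>
  define d where "d = nabla s P (v \<otimes> y) - (y \<bullet> A) *\<^sub>R v"
  have "d \<in> fst P"
    unfolding d_def nabla_def by (intro subspace_diff subspace_scale oproj_in V v)
  then have "d \<bullet> d = 0" using inner[of d] unfolding d_def by (simp add: inner_diff_left)
  then show ?thesis by (simp add: d_def)
qed

theorem theorem2p2:
  fixes s :: "('a::euclidean_space, 'k::finite) oplane \<Rightarrow> 'a"
  assumes "CARD('k) > 1" and "DIM('a) - CARD('k) > 1"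
    and "s \<in> sections_taut"
  shows "(\<forall>P\<in>oriented_grassmannian. twistor_D s P = 0) \<longleftrightarrow>
    (\<exists>s'\<in>sections_perp. \<exists>A. \<forall>P\<in>oriented_grassmannian. s P + s' P = A)"
proof -
  have s: "smooth_on_grassmannian s" "\<And>P. P \<in> oriented_grassmannian \<Longrightarrow> s P \<in> fst P"
    using assms(3) by (auto simp: sections_taut_def)
  have kn: "CARD('k) < DIM('a)" using assms(2) by simp
  show ?thesis
  proof
    assume "\<forall>P\<in>oriented_grassmannian. twistor_D s P = 0"
    then obtain A where A: "\<And>P w. P \<in> oriented_grassmannian \<Longrightarrow> w \<in> fst P \<Longrightarrow> s P \<bullet> w = A \<bullet> w"
      using section_is_projection[OF s(1) _ assms(1) kn] by blast
    have "smooth_on_grassmannian (\<lambda>P. A - s P)"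
      using s(1) unfolding smooth_on_grassmannian_def smooth_def
      by (intro ballI allI Cm_const_minus) blast
    then have "(\<lambda>P. A - s P) \<in> sections_perp"
      using A by (auto simp: sections_perp_def orthogonal_comp_iff inner_diff_right inner_commute)
    then show "\<exists>s'\<in>sections_perp. \<exists>A. \<forall>P\<in>oriented_grassmannian. s P + s' P = A"
      by (intro bexI[of _ "\<lambda>P. A - s P"] exI[of _ A]) auto
  next
    assume "\<exists>s'\<in>sections_perp. \<exists>A. \<forall>P\<in>oriented_grassmannian. s P + s' P = A"
    then obtain s' A where s': "s' \<in> sections_perp" "\<And>P. P \<in> oriented_grassmannian \<Longrightarrow> s P + s' P = A"
      by blast
    have A: "s P \<bullet> w = A \<bullet> w" if "P \<in> oriented_grassmannian" "w \<in> fst P" for P w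
    proof -
      have "w \<bullet> s' P = 0" using s'(1) that by (auto simp: sections_perp_def orthogonal_comp_iff)
      then show ?thesis
        using s'(2)[OF that(1), symmetric] by (simp add: inner_add_left inner_commute[of "s' P"])
    qed
    show "\<forall>P\<in>oriented_grassmannian. twistor_D s P = 0"
    proof
      fix P :: "('a, 'k) oplane" assume P: "P \<in> oriented_grassmannian"
      note W = subspace_orthogonal_comp[of "fst P"]
      have "nabla s P (v \<otimes> y) = (y \<bullet> oproj ((fst P)\<^sup>\<bottom>) A) *\<^sub>R v"
        if "v \<in> fst P" "y \<in> (fst P)\<^sup>\<bottom>" for v y
        using nabla_projection_of_constant[OF assms(3) A P that] inner_oproj[OF W that(2), of A]
        by (simp add: inner_commute)
      then show "twistor_D s P = 0"
        using twistor_D_eq_0_iff[OF s(1) P] oproj_in(1)[OF W] by blast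
    qed
  qed
qed

end
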